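(* Let $k$ be an algebraically closed field and let $n\ge 1$. Then any ideal $I\subsetneq k[x_1,\dots,x_n]$ has a solution in $k^n$; that is, there exists $a\in k^n$ such that $f(a)=0$ for every $f\in I$. *)

theory Defs
  imports
    "HOL-Algebra.Algebraic_Closure_Type"
    "HOL-Analysis.Finite_Cartesian_Product"
    "HOL-Library.Poly_Mapping"
begin

text \<open>
  The polynomial ring in finitely many variables, indexed by a finite type \<open>'n\<close> (so the number of
  variables is \<open>CARD('n)\<close>, which is at least 1). A monomial is its exponent vector \<open>'n \<Rightarrow>\<^sub>0 nat\<close>, a
  polynomial is a finitely supported coefficient function on monomials, and multiplication on
  \<open>\<Rightarrow>\<^sub>0\<close> is convolution.
\<close>

type_synonym ('n, 'k) mpoly = "('n \<Rightarrow>\<^sub>0 nat) \<Rightarrow>\<^sub>0 'k"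

abbreviation mpoly_ring :: "('n::finite, 'k::field) mpoly ring"
  where "mpoly_ring \<equiv> ring_of_type_algebra"

definition mpoly_eval :: "('n::finite, 'k::field) mpoly \<Rightarrow> 'k ^ 'n \<Rightarrow> 'k"
  where "mpoly_eval f a =
    (\<Sum>m\<in>Poly_Mapping.keys f.
       Poly_Mapping.lookup f m * (\<Prod>i\<in>UNIV. vec_nth a i ^ Poly_Mapping.lookup m i))"

end

theory Submission
  imports Defs
begin

text \<open>
  Enlarge \<open>I\<close> to a maximal, hence prime, ideal \<open>P\<close> and build the point one coordinate at a time.
  Let \<open>A\<close> be the subring of polynomials in the variables treated so far and \<open>x\<close> the next variable.
  For every \<open>b \<in> A[x] - P\<close> there is \<open>a \<in> A - P\<close> such that each point of the zero set of \<open>P \<inter> A\<close> at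
  which \<open>a\<close> does not vanish extends to a point of the zero set of \<open>P \<inter> A[x]\<close> at which \<open>b\<close> does not
  vanish. If \<open>x\<close> is transcendental modulo \<open>P\<close>, a coefficient of \<open>b\<close> serves as \<open>a\<close>. If \<open>x\<close> is
  algebraic, the new coordinate is a root of a relation \<open>p\<close> of least degree, and \<open>a\<close> is the product
  of the leading coefficient of \<open>p\<close> and an element of \<open>A - P\<close> that is a multiple of \<open>b\<close> modulo \<open>P\<close>.
  Working with a prime ideal instead of the quotient domain keeps everything in one type.
\<close>

section \<open>Polynomials over a subring\<close>

text \<open>\<open>A\<close> is an arbitrary set because a prime ideal \<open>P\<close> is inserted
  as well: \<open>F \<in> polys_over P\<close> says that \<open>F\<close> vanishes modulo
  \<open>P\<close>.\<close>

definition polys_over :: "'a::comm_ring_1 set \<Rightarrow> 'a poly set"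
  where "polys_over A = {F. \<forall>i. coeff F i \<in> A}"

definition adjoin :: "'a::comm_ring_1 set \<Rightarrow> 'a \<Rightarrow> 'a set"
  where "adjoin A x = (\<lambda>F. poly F x) ` polys_over A"

locale subring_set =
  fixes A :: "'a::comm_ring_1 set"
  assumes one_in [simp]: "1 \<in> A"
    and diff_in: "a \<in> A \<Longrightarrow> b \<in> A \<Longrightarrow> a - b \<in> A"
    and mult_in: "a \<in> A \<Longrightarrow> b \<in> A \<Longrightarrow> a * b \<in> A"
begin

lemma zero_in [simp]: "0 \<in> A"
  using diff_in[of 1 1] by simp

lemma add_in: "a \<in> A \<Longrightarrow> b \<in> A \<Longrightarrow> a + b \<in> A"
  using diff_in[of a "0 - b"] diff_in[of 0 b] by simp

lemma power_in: "a \<in> A \<Longrightarrow> a ^ n \<in> A"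
  by (induction n) (auto intro: mult_in)

lemma sum_in: "(\<And>i. i \<in> S \<Longrightarrow> f i \<in> A) \<Longrightarrow> sum f S \<in> A"
  by (induction S rule: infinite_finite_induct) (auto intro: add_in)

lemma polys_over_zero [simp]: "0 \<in> polys_over A"
  by (simp add: polys_over_def)

lemma polys_over_const: "a \<in> A \<Longrightarrow> [:a:] \<in> polys_over A"
  by (auto simp: polys_over_def coeff_pCons split: nat.split)

lemma polys_over_var: "[:0, 1:] \<in> polys_over A"
  by (auto simp: polys_over_def coeff_pCons split: nat.split)

lemma polys_over_monom: "a \<in> A \<Longrightarrow> monom a n \<in> polys_over A"
  by (auto simp: polys_over_def)

lemma polys_over_add: "F \<in> polys_over A \<Longrightarrow> G \<in> polys_over A \<Longrightarrow> F + G \<in> polys_over A"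
  by (auto simp: polys_over_def intro: add_in)

lemma polys_over_diff: "F \<in> polys_over A \<Longrightarrow> G \<in> polys_over A \<Longrightarrow> F - G \<in> polys_over A"
  by (auto simp: polys_over_def intro: diff_in)

lemma polys_over_smult: "a \<in> A \<Longrightarrow> F \<in> polys_over A \<Longrightarrow> smult a F \<in> polys_over A"
  by (auto simp: polys_over_def intro: mult_in)

lemma polys_over_mult: "F \<in> polys_over A \<Longrightarrow> G \<in> polys_over A \<Longrightarrow> F * G \<in> polys_over A"
  by (auto simp: polys_over_def coeff_mult intro!: mult_in sum_in)

lemma adjoin_base: "a \<in> A \<Longrightarrow> a \<in> adjoin A x"
  unfolding adjoin_def by (rule image_eqI[of _ _ "[:a:]"]) (auto intro: polys_over_const)

lemma adjoin_var: "x \<in> adjoin A x"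
  unfolding adjoin_def by (rule image_eqI[of _ _ "[:0, 1:]"]) (auto intro: polys_over_var)

lemma subring_adjoin: "subring_set (adjoin A x)"
proof
  show "1 \<in> adjoin A x"
    by (simp add: adjoin_base)
next
  fix a b assume "a \<in> adjoin A x" "b \<in> adjoin A x"
  then obtain F G where FG: "F \<in> polys_over A" "a = poly F x" "G \<in> polys_over A" "b = poly G x"
    by (auto simp: adjoin_def)
  have "poly (F - G) x \<in> adjoin A x" "poly (F * G) x \<in> adjoin A x"
    unfolding adjoin_def using FG by (blast intro: polys_over_diff polys_over_mult)+
  then show "a - b \<in> adjoin A x" "a * b \<in> adjoin A x"
    using FG by simp_all
qed

text \<open>Long division, with multiplication by \<open>lead_coeff G\<close> in place of division
  by it, so that all coefficients stay in \<open>A\<close>. The bound on \<open>degree Q\<close> is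
  what later makes a cofactor of \<open>p\<close> have lower degree than \<open>p\<close>.\<close>

lemma pseudo_division:
  assumes G: "G \<in> polys_over A" "degree G > 0" and "F \<in> polys_over A"
  shows "\<exists>k. \<exists>Q\<in>polys_over A. \<exists>R\<in>polys_over A.
    smult (lead_coeff G ^ k) F = Q * G + R \<and> degree R < degree G \<and> degree Q \<le> degree F - degree G"
  using assms(3)
proof (induction "degree F" arbitrary: F rule: less_induct)
  case less
  show ?case
  proof (cases "degree F < degree G")
    case True
    then show ?thesis
      using less.prems by (intro exI[of _ 0] bexI[of _ 0] bexI[of _ F]) auto
  next
    case False
    define T where "T = monom (lead_coeff F) (degree F - degree G)"
    define F' where "F' = smult (lead_coeff G) F - T * G"
    have lc: "lead_coeff F \<in> A" "lead_coeff G \<in> A"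
      using less.prems G by (auto simp: polys_over_def)
    have T: "T \<in> polys_over A" "degree T \<le> degree F - degree G"
      using lc by (auto simp: T_def polys_over_monom degree_monom_le)
    have F': "F' \<in> polys_over A"
      using lc T G less.prems unfolding F'_def
      by (intro polys_over_diff polys_over_smult polys_over_mult)
    have "degree (T * G) \<le> degree F"
      using degree_mult_le[of T G] T False by linarith
    then have "degree F' \<le> degree F"
      unfolding F'_def by (intro degree_diff_le) (auto intro: order.trans[OF degree_smult_le])
    moreover have "coeff F' (degree F) = 0"
    proof -
      have "coeff (T * G) (degree F) = lead_coeff F * lead_coeff G"
        using False by (simp add: T_def coeff_monom_mult)
      then show ?thesis
        by (simp add: F'_def)
    qed
    \<comment> \<open>Equal degrees would force \<open>F' = 0\<close>, hence
      \<open>degree F = 0\<close>, against \<open>degree F \<ge> degree G > 0\<close>.\<close>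
    ultimately have deg: "degree F' < degree F"
      using False G(2)
      by (metis gr_implies_not0 le_neq_implies_less leading_coeff_0_iff linorder_not_le degree_0)
    obtain k Q R where QR: "Q \<in> polys_over A" "R \<in> polys_over A"
      "smult (lead_coeff G ^ k) F' = Q * G + R" "degree R < degree G"
      "degree Q \<le> degree F' - degree G"
      using less.hyps[OF deg F'] by blast
    define Q' where "Q' = Q + smult (lead_coeff G ^ k) T"
    have "Q' \<in> polys_over A"
      unfolding Q'_def using QR T lc by (intro polys_over_add polys_over_smult power_in)
    moreover have "smult (lead_coeff G ^ Suc k) F = Q' * G + R"
    proof -
      have "smult (lead_coeff G) F = F' + T * G"
        by (simp add: F'_def)
      then have "smult (lead_coeff G ^ Suc k) F = smult (lead_coeff G ^ k) (F' + T * G)"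
        by (metis power_Suc2 smult_smult)
      then show ?thesis
        by (simp add: smult_add_right QR Q'_def algebra_simps)
    qed
    moreover have "degree Q' \<le> degree F - degree G"
      unfolding Q'_def using QR(5) deg T(2)
      by (intro degree_add_le) (auto intro: order.trans[OF degree_smult_le])
    ultimately show ?thesis
      using QR by blast
  qed
qed

end

section \<open>Relations modulo a prime ideal\<close>

text \<open>\<open>P\<close> is a prime ideal of the whole ring, not of \<open>A\<close>, so that
  one \<open>P\<close> serves all subrings of the tower.\<close>

locale prime_over_subring = subring_set A for A :: "'a::comm_ring_1 set" +
  fixes P :: "'a set"
  assumes P_zero [simp]: "0 \<in> P"
    and P_add: "a \<in> P \<Longrightarrow> b \<in> P \<Longrightarrow> a + b \<in> P"
    and P_mult: "a \<in> P \<Longrightarrow> r * a \<in> P"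
    and P_one: "1 \<notin> P"
    and P_prime: "a * b \<in> P \<Longrightarrow> a \<in> P \<or> b \<in> P"
begin

lemma P_diff: "a \<in> P \<Longrightarrow> b \<in> P \<Longrightarrow> a - b \<in> P"
  using P_add[of a "-b"] P_mult[of b "-1"] by simp

lemma P_mult': "a \<in> P \<Longrightarrow> a * r \<in> P"
  using P_mult[of a r] by (simp add: mult.commute)

lemma P_sum: "(\<And>i. i \<in> S \<Longrightarrow> f i \<in> P) \<Longrightarrow> sum f S \<in> P"
  by (induction S rule: infinite_finite_induct) (auto intro: P_add)

lemma P_power: "a ^ n \<in> P \<Longrightarrow> a \<in> P"
  using P_one by (induction n) (auto dest: P_prime)

lemma poly_in_P: "F \<in> polys_over P \<Longrightarrow> poly F x \<in> P"
  by (auto simp: poly_altdef polys_over_def intro!: P_sum P_mult')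

text \<open>For \<open>Q = P\<close> this is the minimal polynomial of \<open>x\<close> modulo
  \<open>P\<close>, up to a scalar that clears denominators. With its leading coefficient outside
  \<open>P\<close>, reduction modulo \<open>P\<close> keeps the degree.\<close>

definition least_relation :: "'a \<Rightarrow> 'a set \<Rightarrow> 'a poly \<Rightarrow> bool"
  where "least_relation x Q G \<longleftrightarrow>
    G \<in> polys_over A \<and> poly G x \<in> Q \<and> lead_coeff G \<notin> P \<and>
    (\<forall>F\<in>polys_over A. degree F < degree G \<longrightarrow> poly F x \<in> Q \<longrightarrow> F \<in> polys_over P)"

text \<open>Such a \<open>Q\<close> is an A[x]-submodule of the ambient ring. The cases of interest
  are \<open>P\<close> itself and \<open>P + b * adjoin A x\<close>.\<close>

definition ideal_between :: "'a \<Rightarrow> 'a set \<Rightarrow> bool"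
  where "ideal_between x Q \<longleftrightarrow> P \<subseteq> Q \<and> (\<forall>s\<in>Q. \<forall>t\<in>Q. s - t \<in> Q) \<and>
    (\<forall>r\<in>adjoin A x. \<forall>t\<in>Q. r * t \<in> Q)"

lemma ideal_between_P: "ideal_between x P"
  by (auto simp: ideal_between_def intro: P_diff P_mult)

text \<open>Among the relations that do not vanish modulo \<open>P\<close>, one of least degree
  works: a leading term with coefficient in \<open>P\<close> could be cut off, leaving such a
  relation of lower degree.\<close>

lemma least_relation_exists:
  assumes Q: "ideal_between x Q"
    and F: "F \<in> polys_over A" "poly F x \<in> Q" "F \<notin> polys_over P"
  obtains G where "least_relation x Q G"
proof -
  let ?R = "\<lambda>G. G \<in> polys_over A \<and> poly G x \<in> Q \<and> G \<notin> polys_over P"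
  obtain G where G: "?R G" and min: "\<And>H. ?R H \<Longrightarrow> degree G \<le> degree H"
    using ex_has_least_nat[of ?R F degree] F by blast
  have "lead_coeff G \<notin> P"
  proof
    assume lc: "lead_coeff G \<in> P"
    define H where "H = G - monom (lead_coeff G) (degree G)"
    have "lead_coeff G \<in> A"
      using G by (auto simp: polys_over_def)
    then have HA: "H \<in> polys_over A"
      unfolding H_def using G by (intro polys_over_diff polys_over_monom) auto
    have "poly (monom (lead_coeff G) (degree G)) x \<in> P"
      using lc by (simp add: poly_monom P_mult')
    then have HQ: "poly H x \<in> Q"
      using G Q unfolding H_def ideal_between_def by (auto simp: poly_diff)
    have HP: "H \<notin> polys_over P"
    proof
      assume HP: "H \<in> polys_over P"
      have "coeff G i \<in> P" for i
      proof (cases "i = degree G")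
        case False
        then have "coeff G i = coeff H i"
          by (simp add: H_def)
        then show ?thesis
          using HP by (simp add: polys_over_def)
      qed (simp add: lc)
      then show False
        using G by (simp add: polys_over_def)
    qed
    then have "degree G \<le> degree H"
      using min HA HQ by blast
    moreover have "degree H \<le> degree G"
      unfolding H_def by (intro degree_diff_le) (auto simp: degree_monom_le)
    moreover have "coeff H (degree G) = 0"
      by (simp add: H_def)
    ultimately have "H = 0"
      by (metis leading_coeff_0_iff order_antisym)
    then show False
      using HP by (simp add: polys_over_def)
  qed
  then have "least_relation x Q G"
    unfolding least_relation_def using G min by (meson linorder_not_less)
  then show ?thesis
    by (rule that)
qed

text \<open>The remainder of pseudo-division again has its value at \<open>x\<close> in
  \<open>Q\<close>, and its degree is below that of \<open>G\<close>, so minimality makes it vanish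
  modulo \<open>P\<close>.\<close>

lemma least_relation_divides:
  assumes Q: "ideal_between x Q" and G: "least_relation x Q G" "degree G > 0"
    and F: "F \<in> polys_over A" "poly F x \<in> Q"
  obtains k H R where "H \<in> polys_over A" "R \<in> polys_over A" "R \<in> polys_over P"
    "smult (lead_coeff G ^ k) F = H * G + R" "degree H \<le> degree F - degree G"
proof -
  have GA: "G \<in> polys_over A"
    using G by (simp add: least_relation_def)
  obtain k H R where HR: "H \<in> polys_over A" "R \<in> polys_over A"
      "smult (lead_coeff G ^ k) F = H * G + R" "degree R < degree G"
      "degree H \<le> degree F - degree G"
    using pseudo_division[OF GA G(2) F(1)] by blast
  have "lead_coeff G \<in> A"
    using GA by (simp add: polys_over_def)
  then have "lead_coeff G ^ k \<in> adjoin A x"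
    by (intro adjoin_base power_in)
  moreover have "poly H x \<in> adjoin A x"
    using HR by (simp add: adjoin_def)
  moreover have "poly R x = lead_coeff G ^ k * poly F x - poly H x * poly G x"
    using arg_cong[OF HR(3), of "\<lambda>F. poly F x"] by simp
  moreover have "poly G x \<in> Q"
    using G by (simp add: least_relation_def)
  ultimately have "poly R x \<in> Q"
    using Q F(2) unfolding ideal_between_def by metis
  then have "R \<in> polys_over P"
    using G(1) HR by (auto simp: least_relation_def)
  then show ?thesis
    using that HR by blast
qed

text \<open>Modulo \<open>P\<close>, \<open>b\<close> is nonzero and algebraic over
  \<open>A\<close>, so it has a nonzero multiple in \<open>A\<close>. In place of a norm or a
  resultant, the proof takes a least relation relative to the ideal generated by \<open>b\<close>
  and shows that it is constant.\<close>

lemma multiple_in_base: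
  assumes B: "b \<in> adjoin A x" "b \<notin> P"
    and p: "least_relation x P p"
  obtains c h where "c \<in> A" "c \<notin> P" "h \<in> adjoin A x" "c - b * h \<in> P"
proof -
  interpret adjoin: subring_set "adjoin A x"
    by (rule subring_adjoin)
  \<comment> \<open>This is \<open>P + b * adjoin A x\<close>; an element of \<open>A\<close> in
    \<open>Q\<close> but outside \<open>P\<close> is the desired \<open>c\<close>.\<close>
  define Q where "Q = {t. \<exists>h\<in>adjoin A x. t - b * h \<in> P}"
  have Q: "ideal_between x Q"
    unfolding ideal_between_def
  proof (intro conjI ballI)
    show "P \<subseteq> Q"
      unfolding Q_def by (auto intro!: bexI[of _ 0])
  next
    fix s t assume "s \<in> Q" "t \<in> Q"
    then obtain g h where gh: "g \<in> adjoin A x" "s - b * g \<in> P" "h \<in> adjoin A x" "t - b * h \<in> P"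
      by (auto simp: Q_def)
    have "s - t - b * (g - h) \<in> P"
      using P_diff[OF gh(2,4)] by (simp add: algebra_simps)
    then show "s - t \<in> Q"
      using gh by (auto simp: Q_def intro: adjoin.diff_in)
  next
    fix r t assume r: "r \<in> adjoin A x" and "t \<in> Q"
    then obtain h where h: "h \<in> adjoin A x" "t - b * h \<in> P"
      by (auto simp: Q_def)
    have "r * t - b * (r * h) \<in> P"
      using P_mult[OF h(2), of r] by (simp add: algebra_simps)
    then show "r * t \<in> Q"
      using h r by (auto simp: Q_def intro: adjoin.mult_in)
  qed
  have PQ: "P \<subseteq> Q"
    using Q by (simp add: ideal_between_def)
  have bQ: "b \<in> Q"
    unfolding Q_def by (auto intro!: bexI[of _ 1])
  have pA: "p \<in> polys_over A" "poly p x \<in> P" "lead_coeff p \<notin> P"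
    and pmin: "\<And>F. F \<in> polys_over A \<Longrightarrow> degree F < degree p \<Longrightarrow> poly F x \<in> P \<Longrightarrow> F \<in> polys_over P"
    using p by (auto simp: least_relation_def)
  have "p \<notin> polys_over P"
    using pA by (auto simp: polys_over_def)
  then obtain G where G: "least_relation x Q G"
    using least_relation_exists[OF Q pA(1)] pA PQ by blast
  then have GA: "G \<in> polys_over A" "poly G x \<in> Q" and lcG: "lead_coeff G \<notin> P"
    by (auto simp: least_relation_def)
  \<comment> \<open>A nonconstant \<open>G\<close> divides \<open>p\<close> modulo \<open>P\<close>,
    up to a power of its leading coefficient, so by primality either the cofactor or
    \<open>G\<close> has its value at \<open>x\<close> in \<open>P\<close>.\<close>
  have "degree G = 0"
  proof (rule ccontr)
    assume "degree G \<noteq> 0"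
    then have dG: "degree G > 0"
      by simp
    have "poly p x \<in> Q"
      using pA PQ by blast
    then obtain k H R where HR: "H \<in> polys_over A" "R \<in> polys_over P"
      "smult (lead_coeff G ^ k) p = H * G + R" "degree H \<le> degree p - degree G"
      using least_relation_divides[OF Q G dG pA(1)] by metis
    have "poly H x * poly G x = lead_coeff G ^ k * poly p x - poly R x"
      using arg_cong[OF HR(3), of "\<lambda>F. poly F x"] by simp
    then have "poly H x * poly G x \<in> P"
      using HR pA by (auto intro: P_diff P_mult poly_in_P)
    then consider "poly H x \<in> P" | "poly G x \<in> P"
      using P_prime by blast
    then show False
    proof cases
      \<comment> \<open>The cofactor \<open>H\<close> has lower degree than \<open>p\<close>, so it
        vanishes modulo \<open>P\<close>. Then so does a multiple of \<open>p\<close> by a scalar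
        outside \<open>P\<close>, against \<open>lead_coeff p \<notin> P\<close>.\<close>
      case 1
      have "degree p \<noteq> 0"
      proof
        assume "degree p = 0"
        then obtain a where "p = [:a:]"
          by (rule degree_eq_zeroE)
        then show False
          using pA by simp
      qed
      then have "degree H < degree p"
        using HR(4) dG by linarith
      then have "H \<in> polys_over P"
        using pmin HR 1 by blast
      then have "H * G + R \<in> polys_over P"
        using HR(2) by (auto simp: polys_over_def coeff_mult intro!: P_add P_sum P_mult')
      then have "lead_coeff G ^ k * lead_coeff p \<in> P"
        unfolding HR(3)[symmetric] by (auto simp: polys_over_def)
      then show False
        using P_prime P_power pA lcG by blast
    next
      \<comment> \<open>As \<open>b \<in> Q\<close>, \<open>G\<close> also divides the polynomial
        \<open>B\<close> that represents \<open>b\<close>, and this would put \<open>b\<close> into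
        \<open>P\<close>.\<close>
      case 2
      obtain B where B': "B \<in> polys_over A" "b = poly B x"
        using B by (auto simp: adjoin_def)
      obtain k H R where HR: "R \<in> polys_over P" "smult (lead_coeff G ^ k) B = H * G + R"
        using least_relation_divides[OF Q G dG B'(1)] bQ B'(2) by metis
      have "lead_coeff G ^ k * b = poly H x * poly G x + poly R x"
        using arg_cong[OF HR(2), of "\<lambda>F. poly F x"] B' by simp
      then have "lead_coeff G ^ k * b \<in> P"
        using HR 2 by (auto intro: P_add P_mult poly_in_P)
      then show False
        using P_prime P_power B lcG by blast
    qed
  qed
  then obtain c where c: "G = [:c:]"
    by (rule degree_eq_zeroE)
  have "c \<in> A"
    using GA(1) unfolding c polys_over_def by (metis (no_types, lifting) coeff_pCons_0 mem_Collect_eq)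
  moreover have "c \<notin> P" "c \<in> Q"
    using lcG GA c by auto
  ultimately show ?thesis
    using that by (auto simp: Q_def)
qed

end

section \<open>Extending a point by one coordinate\<close>

locale type_ring_hom =
  fixes h :: "'a::comm_ring_1 \<Rightarrow> 'b::comm_ring_1"
  assumes hom_add: "h (a + b) = h a + h b"
    and hom_mult: "h (a * b) = h a * h b"
    and hom_one: "h 1 = 1"
begin

lemma hom_zero: "h 0 = 0"
  using hom_add[of 0 0] by simp

lemma hom_poly: "h (poly F x) = poly (map_poly h F) (h x)"
  by (induction F) (auto simp: map_poly_pCons hom_zero hom_add hom_mult)

end

text \<open>\<open>E \<xi>\<close> models evaluation at a point whose new coordinate is \<xi> and
  whose earlier coordinates are fixed. On \<open>A\<close> the whole family agrees, and
  \<open>E 0\<close> is the representative chosen there.\<close>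

locale hom_family = subring_set A for A :: "'a::comm_ring_1 set" +
  fixes x :: 'a and E :: "'b::comm_ring_1 \<Rightarrow> 'a \<Rightarrow> 'b"
  assumes hom: "type_ring_hom (E \<xi>)"
    and var: "E \<xi> x = \<xi>"
    and indep: "f \<in> A \<Longrightarrow> E \<xi> f = E \<eta> f"
begin

sublocale type_ring_hom "E \<xi>" for \<xi>
  by (rule hom)

lemma family_poly:
  assumes "F \<in> polys_over A"
  shows "E \<xi> (poly F x) = poly (map_poly (E 0) F) \<xi>"
proof -
  have "map_poly (E \<xi>) F = map_poly (E 0) F"
    using assms by (intro poly_eqI) (auto simp: coeff_map_poly hom_zero polys_over_def intro: indep)
  then show ?thesis
    by (simp add: hom_poly var)
qed

end

text \<open>Otherwise 1 plus the product of all X - a would be a polynomial of positive degree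
  without a root.\<close>

lemma infinite_alg_closed_field: "infinite (UNIV :: 'k::alg_closed_field set)"
proof
  assume fin: "finite (UNIV :: 'k set)"
  define F :: "'k poly" where "F = 1 + (\<Prod>a\<in>UNIV. [:-a, 1:])"
  have deg: "degree (\<Prod>a\<in>(UNIV::'k set). [:-a, 1:]) = card (UNIV :: 'k set)"
    by (subst degree_prod_eq_sum_degree) auto
  have "card (UNIV :: 'k set) > 0"
    using fin by (simp add: card_gt_0_iff)
  then have "degree F > 0"
    unfolding F_def by (subst degree_add_eq_right) (auto simp: deg)
  then obtain x where "poly F x = 0"
    using alg_closed_imp_poly_has_root by blast
  moreover have "(\<Prod>a\<in>UNIV. x - a) = 0"
    using fin by (auto simp: prod_zero_iff)
  ultimately show False
    by (simp add: F_def poly_prod)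
qed

context prime_over_subring
begin

text \<open>The element \<open>a\<close> is chosen before \<open>E\<close>. This order lets an
  induction first secure a point at which \<open>a\<close> does not vanish and then extend
  it.\<close>

lemma extend_hom:
  assumes b: "b \<in> adjoin A x" "b \<notin> P"
  shows "\<exists>a\<in>A. a \<notin> P \<and> (\<forall>E :: 'k::alg_closed_field \<Rightarrow> 'a \<Rightarrow> 'k.
    hom_family A x E \<longrightarrow> (\<forall>f\<in>A \<inter> P. E 0 f = 0) \<longrightarrow> E 0 a \<noteq> 0 \<longrightarrow>
      (\<exists>\<xi>. (\<forall>f\<in>adjoin A x \<inter> P. E \<xi> f = 0) \<and> E \<xi> b \<noteq> 0))"
proof (cases "\<exists>F\<in>polys_over A. poly F x \<in> P \<and> F \<notin> polys_over P")
  \<comment> \<open>Here \<open>x\<close> is transcendental modulo \<open>P\<close>: every relation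
    has all its coefficients in \<open>P\<close>, so it holds at every \<xi>, and only
    \<open>E \<xi> b \<noteq> 0\<close> restricts the choice.\<close>
  case False
  obtain B where B: "B \<in> polys_over A" "b = poly B x"
    using b by (auto simp: adjoin_def)
  then have "B \<notin> polys_over P"
    using b poly_in_P by auto
  then obtain i where i: "coeff B i \<notin> P"
    by (auto simp: polys_over_def)
  show ?thesis
  proof (intro bexI[of _ "coeff B i"] conjI allI impI)
    show "coeff B i \<in> A" "coeff B i \<notin> P"
      using B i by (auto simp: polys_over_def)
  next
    fix E :: "'k \<Rightarrow> 'a \<Rightarrow> 'k"
    assume "hom_family A x E" and zero_base: "\<forall>f\<in>A \<inter> P. E 0 f = 0" and nz: "E 0 (coeff B i) \<noteq> 0"
    then interpret hom_family A x E
      by simp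
    have "map_poly (E 0) B \<noteq> 0"
      using nz by (metis coeff_0 coeff_map_poly hom_zero)
    then have "{\<xi>. poly (map_poly (E 0) B) \<xi> = 0} \<noteq> UNIV"
      using poly_roots_finite infinite_alg_closed_field by metis
    then obtain \<xi> where "E \<xi> b \<noteq> 0"
      using family_poly B by auto
    moreover have "E \<xi> f = 0" if f: "f \<in> adjoin A x \<inter> P" for f
    proof -
      obtain F where F: "F \<in> polys_over A" "f = poly F x"
        using f by (auto simp: adjoin_def)
      then have "F \<in> polys_over P"
        using False f by auto
      then have "map_poly (E 0) F = 0"
        using F by (intro poly_eqI) (auto simp: coeff_map_poly hom_zero polys_over_def zero_base)
      then show ?thesis
        using family_poly F by simp
    qed
    ultimately show "\<exists>\<xi>. (\<forall>f\<in>adjoin A x \<inter> P. E \<xi> f = 0) \<and> E \<xi> b \<noteq> 0"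
      by blast
  qed
next
  \<comment> \<open>Here \<open>x\<close> is algebraic modulo \<open>P\<close>, and \<xi> has to be
    a root of the image of \<open>p\<close>. The factor \<open>lead_coeff p\<close> keeps this image
    nonconstant, and the factor \<open>c\<close> keeps \<open>b\<close> from vanishing.\<close>
  case True
  then obtain p where p: "least_relation x P p"
    using least_relation_exists[OF ideal_between_P] by metis
  then have pA: "p \<in> polys_over A" "poly p x \<in> P" "lead_coeff p \<notin> P"
    by (auto simp: least_relation_def)
  have dp: "degree p > 0"
  proof (rule ccontr)
    assume "\<not> degree p > 0"
    then obtain a where "p = [:a:]"
      by (metis degree_eq_zeroE gr0I)
    then show False
      using pA by simp
  qed
  obtain c h where c: "c \<in> A" "c \<notin> P" "h \<in> adjoin A x" "c - b * h \<in> P"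
    using multiple_in_base[OF b p] by blast
  have lcA: "lead_coeff p \<in> A"
    using pA by (auto simp: polys_over_def)
  show ?thesis
  proof (intro bexI[of _ "lead_coeff p * c"] conjI allI impI)
    show "lead_coeff p * c \<in> A" "lead_coeff p * c \<notin> P"
      using lcA c pA by (auto intro: mult_in dest: P_prime)
  next
    fix E :: "'k \<Rightarrow> 'a \<Rightarrow> 'k"
    assume "hom_family A x E" and zero_base: "\<forall>f\<in>A \<inter> P. E 0 f = 0" and nz: "E 0 (lead_coeff p * c) \<noteq> 0"
    then interpret hom_family A x E
      by simp
    have nz': "E \<xi> (lead_coeff p) \<noteq> 0" "E \<xi> c \<noteq> 0" for \<xi>
      using nz indep[of "lead_coeff p" \<xi> 0] indep[of c \<xi> 0] lcA c by (auto simp: hom_mult)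
    have "coeff (map_poly (E 0) p) (degree p) \<noteq> 0"
      using nz' by (simp add: coeff_map_poly hom_zero)
    then have "degree (map_poly (E 0) p) > 0"
      using dp by (meson le_degree less_le_trans)
    then obtain \<xi> where \<xi>: "poly (map_poly (E 0) p) \<xi> = 0"
      using alg_closed_imp_poly_has_root by blast
    \<comment> \<open>Up to a power of \<open>lead_coeff p\<close>, \<open>f\<close> is a multiple
      of \<open>poly p x\<close> plus a remainder with coefficients in \<open>A \<inter> P\<close>;
      both are sent to 0, but the power is not.\<close>
    have zero: "E \<xi> f = 0" if f: "f \<in> adjoin A x" "f \<in> P" for f
    proof -
      obtain F where F: "F \<in> polys_over A" "f = poly F x"
        using f by (auto simp: adjoin_def)
      obtain k H R where HR: "R \<in> polys_over A" "R \<in> polys_over P"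
        "smult (lead_coeff p ^ k) F = H * p + R"
        using least_relation_divides[OF ideal_between_P p dp F(1)] F(2) f(2) by metis
      have R0: "map_poly (E 0) R = 0"
        using HR by (intro poly_eqI) (auto simp: coeff_map_poly hom_zero polys_over_def zero_base)
      have "lead_coeff p ^ k * f = poly H x * poly p x + poly R x"
        using arg_cong[OF HR(3), of "\<lambda>F. poly F x"] F by simp
      then have "E \<xi> (lead_coeff p ^ k * f) = E \<xi> (poly H x) * E \<xi> (poly p x) + E \<xi> (poly R x)"
        by (simp add: hom_add hom_mult)
      also have "\<dots> = 0"
        using family_poly[OF pA(1)] family_poly[OF HR(1)] \<xi> R0 by simp
      finally have "E \<xi> (lead_coeff p ^ k) * E \<xi> f = 0"
        by (simp add: hom_mult)
      moreover have "E \<xi> (lead_coeff p ^ k) \<noteq> 0"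
        using nz' by (induction k) (auto simp: hom_mult hom_one)
      ultimately show ?thesis
        by simp
    qed
    interpret adjoin: subring_set "adjoin A x"
      by (rule subring_adjoin)
    have "c - b * h \<in> adjoin A x"
      using adjoin.diff_in[OF adjoin_base[OF c(1)] adjoin.mult_in[OF b(1) c(3)]] .
    then have "E \<xi> (c - b * h) = 0"
      using zero c by blast
    then have "E \<xi> c = E \<xi> b * E \<xi> h"
      using hom_add[of \<xi> "c - b * h" "b * h"] by (simp add: hom_mult)
    then have "E \<xi> b \<noteq> 0"
      using nz'(2)[of \<xi>] by auto
    then show "\<exists>\<xi>. (\<forall>f\<in>adjoin A x \<inter> P. E \<xi> f = 0) \<and> E \<xi> b \<noteq> 0"
      using zero by blast
  qed
qed

end

section \<open>Evaluation of multivariate polynomials\<close>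

abbreviation mconst :: "'k::field \<Rightarrow> ('n::finite, 'k) mpoly"
  where "mconst \<equiv> Poly_Mapping.single 0"

abbreviation mvar :: "'n::finite \<Rightarrow> ('n, 'k::field) mpoly"
  where "mvar i \<equiv> Poly_Mapping.single (Poly_Mapping.single i 1) 1"

text \<open>Serves both layers of a polynomial: coefficient functions on monomials and exponent
  vectors on variables.\<close>

lemma poly_mapping_add_induct [case_names zero single add]:
  fixes f :: "'a \<Rightarrow>\<^sub>0 'b::comm_monoid_add"
  assumes "P 0" and single: "\<And>m c. P (Poly_Mapping.single m c)"
    and add: "\<And>f g. P f \<Longrightarrow> P g \<Longrightarrow> P (f + g)"
  shows "P f"
proof (induction f rule: update_induct)
  case const
  show ?case by fact
next
  case (update f a b)
  have "Poly_Mapping.update a b f = Poly_Mapping.single a b + f"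
    using update(1)
    by (intro poly_mapping_eqI) (auto simp: lookup_update lookup_add lookup_single when_def in_keys_iff)
  then show ?case
    using single add update by metis
qed

text \<open>Supports may shrink under addition by cancellation; a common index set makes additivity
  a termwise identity.\<close>

lemma mpoly_eval_superset:
  assumes "finite M" "Poly_Mapping.keys f \<subseteq> M"
  shows "mpoly_eval f a =
    (\<Sum>m\<in>M. Poly_Mapping.lookup f m * (\<Prod>i\<in>UNIV. vec_nth a i ^ Poly_Mapping.lookup m i))"
  unfolding mpoly_eval_def using assms
  by (intro sum.mono_neutral_left) (auto simp: in_keys_iff)

lemma mpoly_eval_single:
  "mpoly_eval (Poly_Mapping.single m c) a = c * (\<Prod>i\<in>UNIV. vec_nth a i ^ Poly_Mapping.lookup m i)"
  by (subst mpoly_eval_superset[of "{m}"]) auto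

lemma mpoly_eval_add: "mpoly_eval (f + g) a = mpoly_eval f a + mpoly_eval g a"
proof -
  let ?M = "Poly_Mapping.keys f \<union> Poly_Mapping.keys g"
  show ?thesis
    using Poly_Mapping.keys_add[of f g]
    by (subst (1 2 3) mpoly_eval_superset[of ?M])
      (auto simp: lookup_add algebra_simps sum.distrib)
qed

lemma mpoly_eval_zero: "mpoly_eval 0 a = 0"
  by (simp add: mpoly_eval_def)

lemma mpoly_eval_mult: "mpoly_eval (f * g) a = mpoly_eval f a * mpoly_eval g a"
proof (induction f rule: poly_mapping_add_induct)
  case (single m c)
  show ?case
  proof (induction g rule: poly_mapping_add_induct)
    case (single m' c')
    show ?case
      by (simp add: mult_single mpoly_eval_single lookup_add power_add prod.distrib)
  qed (simp_all add: mpoly_eval_zero mpoly_eval_add distrib_left)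
qed (simp_all add: mpoly_eval_zero mpoly_eval_add distrib_right)

lemma mpoly_eval_const: "mpoly_eval (mconst c) a = c"
  by (simp add: mpoly_eval_single)

lemma mpoly_eval_var: "mpoly_eval (mvar i) a = vec_nth a i"
proof -
  have "(\<Prod>j\<in>UNIV. vec_nth a j ^ Poly_Mapping.lookup (Poly_Mapping.single i (1::nat)) j)
      = (\<Prod>j\<in>UNIV. if j = i then vec_nth a j else 1)"
    by (intro prod.cong) (auto simp: lookup_single when_def)
  then show ?thesis
    by (simp add: mpoly_eval_single)
qed

lemma mpoly_eval_one: "mpoly_eval 1 a = 1"
  by (simp add: mpoly_eval_const flip: single_one)

text \<open>The polynomial ring in the variables from \<open>S\<close>, kept inside the full ring.
  Generation by ring operations, in place of a condition on supports, provides the inductions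
  below.\<close>

inductive_set polys_in :: "'n::finite set \<Rightarrow> ('n, 'k::field) mpoly set" for S where
  const: "mconst c \<in> polys_in S"
| var: "i \<in> S \<Longrightarrow> mvar i \<in> polys_in S"
| add: "f \<in> polys_in S \<Longrightarrow> g \<in> polys_in S \<Longrightarrow> f + g \<in> polys_in S"
| mult: "f \<in> polys_in S \<Longrightarrow> g \<in> polys_in S \<Longrightarrow> f * g \<in> polys_in S"

lemma subring_polys_in: "subring_set (polys_in S)"
proof
  show "1 \<in> polys_in S"
    using polys_in.const[of 1] by simp
  show "a - b \<in> polys_in S" if "a \<in> polys_in S" "b \<in> polys_in S" for a b :: "('a, 'b) mpoly"
  proof -
    have "a + mconst (-1) * b \<in> polys_in S"
      using that by (intro polys_in.intros)
    then show ?thesis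
      by (simp add: single_uminus)
  qed
qed (rule polys_in.mult)

lemma polys_in_empty: "f \<in> polys_in {} \<Longrightarrow> \<exists>c. f = mconst c"
proof (induction rule: polys_in.induct)
  case (add f g)
  then show ?case
    by (metis single_add)
next
  case (mult f g)
  then show ?case
    by (metis mult_single add_0)
qed auto

lemma polys_in_insert: "f \<in> polys_in (insert i S) \<Longrightarrow> f \<in> adjoin (polys_in S) (mvar i)"
proof (induction rule: polys_in.induct)
  interpret subring_set "polys_in S"
    by (rule subring_polys_in)
  interpret adjoin: subring_set "adjoin (polys_in S) (mvar i)"
    by (rule subring_adjoin)
  {
    case (const c)
    show ?case
      by (intro adjoin_base polys_in.const)
  next
    case (var j)
    then show ?case
      by (metis adjoin_base adjoin_var insert_iff polys_in.var)
  next
    case (add f g)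
    then show ?case
      by (intro adjoin.add_in)
  next
    case (mult f g)
    then show ?case
      by (intro adjoin.mult_in)
  }
qed

lemma polys_in_UNIV:
  fixes f :: "('n::finite, 'k::field) mpoly"
  shows "f \<in> polys_in UNIV"
proof (induction f rule: poly_mapping_add_induct)
  case zero
  show ?case
    using polys_in.const[of 0] by simp
next
  case (add f g)
  then show ?case
    by (rule polys_in.add)
next
  case (single m c)
  \<comment> \<open>The exponent vector is split into multiples of unit vectors, each of which gives
    a power of one variable.\<close>
  have "Poly_Mapping.single m (1::'k) \<in> polys_in UNIV"
  proof (induction m rule: poly_mapping_add_induct)
    case zero
    show ?case
      by (rule polys_in.const)
  next
    case (add m m')
    have "Poly_Mapping.single (m + m') 1 = Poly_Mapping.single m 1 * Poly_Mapping.single m' (1::'k)"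
      by (simp add: mult_single)
    then show ?case
      using add by (auto intro: polys_in.mult)
  next
    case (single i k)
    show ?case
    proof (induction k)
      case 0
      show ?case
        using polys_in.const[of 1] by simp
    next
      case (Suc k)
      have "Poly_Mapping.single (Poly_Mapping.single i (Suc k)) 1 =
          mvar i * Poly_Mapping.single (Poly_Mapping.single i k) (1::'k)"
        by (simp add: mult_single flip: single_add)
      then show ?case
        using polys_in.mult[OF polys_in.var Suc] by simp
    qed
  qed
  moreover have "Poly_Mapping.single m c = mconst c * Poly_Mapping.single m 1"
    by (simp add: mult_single)
  ultimately show ?case
    by (auto intro: polys_in.intros)
qed

lemma mpoly_eval_cong:
  "f \<in> polys_in S \<Longrightarrow> (\<And>i. i \<in> S \<Longrightarrow> vec_nth a i = vec_nth a' i) \<Longrightarrow> mpoly_eval f a = mpoly_eval f a'"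
  by (induction rule: polys_in.induct)
    (auto simp: mpoly_eval_const mpoly_eval_var mpoly_eval_add mpoly_eval_mult simp del: One_nat_def)

section \<open>The weak Nullstellensatz\<close>

text \<open>The condition on \<open>b\<close> strengthens the claim for the induction: a point for
  \<open>S\<close> is known to extend where the element \<open>d\<close> from
  \<open>extend_hom\<close> does not vanish, so the induction hypothesis is applied to
  \<open>d\<close>.\<close>

lemma prime_ideal_has_zero:
  fixes P :: "('n::finite, 'k::alg_closed_field) mpoly set"
  assumes P: "\<And>S. prime_over_subring (polys_in S) P"
    and "finite S" "b \<in> polys_in S" "b \<notin> P"
  shows "\<exists>a. (\<forall>f\<in>polys_in S \<inter> P. mpoly_eval f a = 0) \<and> mpoly_eval b a \<noteq> 0"
  using assms(2-)
proof (induction S arbitrary: b rule: finite_induct)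
  \<comment> \<open>Without variables only constants remain. A nonzero constant is a unit and cannot
    lie in \<open>P\<close>, so every point will do.\<close>
  case empty
  interpret prime_over_subring "polys_in {}" P
    by (rule P)
  have "c = 0" if "mconst c \<in> P" for c
  proof (rule ccontr)
    assume "c \<noteq> 0"
    then have "mconst (inverse c) * mconst c = (1 :: ('n, 'k) mpoly)"
      by (simp add: mult_single)
    then show False
      using P_mult[OF that, of "mconst (inverse c)"] P_one by simp
  qed
  moreover obtain c where "b = mconst c"
    using polys_in_empty empty by blast
  ultimately show ?case
    using polys_in_empty empty by (fastforce simp: mpoly_eval_const)
next
  case (insert i S)
  interpret prime_over_subring "polys_in S" P
    by (rule P)
  have "b \<in> adjoin (polys_in S) (mvar i)"
    using insert by (intro polys_in_insert)
  then obtain d where d: "d \<in> polys_in S" "d \<notin> P" and ext: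
    "\<forall>E :: 'k \<Rightarrow> ('n, 'k) mpoly \<Rightarrow> 'k. hom_family (polys_in S) (mvar i) E \<longrightarrow>
      (\<forall>f\<in>polys_in S \<inter> P. E 0 f = 0) \<longrightarrow> E 0 d \<noteq> 0 \<longrightarrow>
      (\<exists>\<xi>. (\<forall>f\<in>adjoin (polys_in S) (mvar i) \<inter> P. E \<xi> f = 0) \<and> E \<xi> b \<noteq> 0)"
    using extend_hom[OF _ insert.prems(2), where ?'k = 'k] by metis
  obtain a where a: "\<And>f. f \<in> polys_in S \<Longrightarrow> f \<in> P \<Longrightarrow> mpoly_eval f a = 0" "mpoly_eval d a \<noteq> 0"
    using insert.IH[OF d] by blast
  \<comment> \<open>Only coordinate \<open>i\<close> moves; as \<open>i \<notin> S\<close>, the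
    values on \<open>polys_in S\<close> stay the same.\<close>
  define a' where "a' \<xi> = (\<chi> j. if j = i then \<xi> else vec_nth a j)" for \<xi>
  have indep: "mpoly_eval f (a' \<xi>) = mpoly_eval f a" if "f \<in> polys_in S" for f \<xi>
    using that insert.hyps by (intro mpoly_eval_cong[where S = S]) (auto simp: a'_def)
  have "\<exists>\<xi>. (\<forall>f\<in>adjoin (polys_in S) (mvar i) \<inter> P. mpoly_eval f (a' \<xi>) = 0) \<and> mpoly_eval b (a' \<xi>) \<noteq> 0"
  proof (rule ext[rule_format])
    show "hom_family (polys_in S) (mvar i) (\<lambda>\<xi> f. mpoly_eval f (a' \<xi>))"
    proof
      fix \<xi>
      show "mpoly_eval (mvar i) (a' \<xi>) = \<xi>"
        unfolding mpoly_eval_var by (simp add: a'_def)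
    qed (simp_all add: indep mpoly_eval_add mpoly_eval_mult mpoly_eval_one)
  qed (use a d in \<open>simp_all add: indep\<close>)
  then show ?case
    using polys_in_insert by blast
qed

text \<open>Zorn's lemma applies because properness, stated as \<open>\<one> \<notin> J\<close>,
  passes to unions of chains.\<close>

lemma (in ring) exists_maximalideal:
  assumes I: "ideal I R" "I \<subset> carrier R"
  obtains M where "maximalideal M R" "I \<subseteq> M"
proof -
  define proper where "proper = {J. ideal J R \<and> I \<subseteq> J \<and> \<one> \<notin> J}"
  have one_iff: "\<one> \<notin> J \<longleftrightarrow> J \<noteq> carrier R" if "ideal J R" for J
    using ideal.one_imp_carrier[OF that] by auto
  have "\<exists>M\<in>proper. \<forall>J\<in>proper. M \<subseteq> J \<longrightarrow> J = M"
  proof (rule subset_Zorn_nonempty)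
    show "proper \<noteq> {}"
      unfolding proper_def using I one_iff[OF I(1)] by auto
  next
    fix C assume C: "C \<noteq> {}" "subset.chain proper C"
    then have "subset.chain {J. ideal J R} C"
      by (auto simp: proper_def pred_on.chain_def)
    then have "ideal (\<Union>C) R"
      using chain_Union_is_ideal[of C] C by simp
    then show "\<Union>C \<in> proper"
      using C by (auto simp: proper_def pred_on.chain_def)
  qed
  then obtain M where M: "ideal M R" "I \<subseteq> M" "\<one> \<notin> M"
    and max: "\<And>J. ideal J R \<Longrightarrow> I \<subseteq> J \<Longrightarrow> \<one> \<notin> J \<Longrightarrow> M \<subseteq> J \<Longrightarrow> J = M"
    by (auto simp: proper_def)
  have "maximalideal M R"
    using M max one_iff by (intro maximalidealI) (auto, blast+)
  then show ?thesis
    using that M by blast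
qed

theorem theorem1:
  fixes I :: "('n::finite, 'k::alg_closed_field) mpoly set"
  assumes "ideal I mpoly_ring"
    and "I \<subset> carrier mpoly_ring"
  shows "\<exists>a :: 'k ^ 'n. \<forall>f\<in>I. mpoly_eval f a = 0"
proof -
  interpret R: cring "mpoly_ring :: ('n, 'k) mpoly ring"
    by (rule cring_from_type_algebra)
  obtain P where P: "maximalideal P mpoly_ring" "I \<subseteq> P"
    using R.exists_maximalideal[OF assms] by blast
  interpret P: primeideal P "mpoly_ring :: ('n, 'k) mpoly ring"
    using R.maximalideal_prime P by blast
  have prime: "prime_over_subring (polys_in S) P" for S
  proof (intro prime_over_subring.intro subring_polys_in, unfold_locales)
    show "0 \<in> P" "\<And>a b. a \<in> P \<Longrightarrow> b \<in> P \<Longrightarrow> a + b \<in> P" "\<And>a r. a \<in> P \<Longrightarrow> r * a \<in> P"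
      "\<And>a b. a * b \<in> P \<Longrightarrow> a \<in> P \<or> b \<in> P" "1 \<notin> P"
      using P.zero_closed P.a_closed P.I_l_closed P.I_prime P.one_imp_carrier P.I_notcarr
      by (auto simp: ring_of_type_algebra_def)
  qed
  \<comment> \<open>Every polynomial lies in \<open>polys_in UNIV\<close>, and \<open>b = 1\<close>
    is admissible because \<open>P\<close> is proper.\<close>
  from prime_ideal_has_zero[OF prime, of UNIV 1] obtain a
    where "\<And>f. f \<in> P \<Longrightarrow> mpoly_eval f a = 0"
    using polys_in_UNIV prime_over_subring.P_one[OF prime] by auto
  then show ?thesis
    using P by blast
qed

end
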